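(* Let $\mu=\prod_{j=1}^\infty|P_j|^2$ be a generalized Riesz product, where each $P_j$ is an analytic trigonometric polynomial with positive constant term, and let $\mu_a$ denote the part of $\mu$ absolutely continuous with respect to $dz$. Then $$\int_{S^1}\log\frac{d\mu_a}{dz}\,dz=\lim_{n\to\infty}\int_{S^1}\log\prod_{j=1}^n|P_j(z)|^2\,dz,$$ where both sides are elements of $[-\infty,0]$ (the value $-\infty$ being allowed).
   Context: $S^1$ is the unit circle and $dz$ denotes normalized Lebesgue measure on $S^1$. An analytic trigonometric polynomial is one of the form $\sum_{i=0}^m a_i z^i$. Generalized Riesz product: a sequence $P_1,P_2,\dots$ of trigonometric polynomials on $S^1$ is said to define a generalized Riesz product if (i) for every finite sequence $i_1<\dots<i_k$ of natural numbers, $\int_{S^1}|P_{i_1}\cdots P_{i_k}(z)|^2\,dz=1$; and (ii) for every infinite sequence $i_1<i_2<\cdots$ of natural numbers, the weak limit of the probability measures $|P_{i_1}\cdots P_{i_k}(z)|^2\,dz$ as $k\to\infty$ exists. The weak limit $\mu$ of $|P_1\cdots P_k|^2dz$ is called the generalized Riesz product and is denoted $\mu=\prod_{j=1}^\infty|P_j|^2$. *)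

theory Defs
  imports "HOL-Probability.Probability" "HOL-Computational_Algebra.Polynomial"
begin

abbreviation circle_borel :: "complex measure" where
  "circle_borel \<equiv> restrict_space borel (sphere 0 1)"

text \<open>Normalized Lebesgue measure \<open>dz\<close> on the unit circle.\<close>

definition circle_measure :: "complex measure" where
  "circle_measure = distr (uniform_measure lborel {0..<2 * pi}) circle_borel cis"

lemma prob_space_circle_measure: "prob_space circle_measure"
proof -
  have "prob_space (uniform_measure lborel {0..<2 * pi})"
    by (rule prob_space_uniform_measure) auto
  moreover have "cis \<in> borel_measurable borel"
    by (intro borel_measurable_continuous_onI continuous_intros)
  then have "cis \<in> uniform_measure lborel {0..<2 * pi} \<rightarrow>\<^sub>M circle_borel"
    by (intro measurable_restrict_space2) auto
  ultimately show ?thesis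
    unfolding circle_measure_def by (rule prob_space.prob_space_distr)
qed

definition trig_polynomial :: "(complex \<Rightarrow> complex) \<Rightarrow> bool" where
  "trig_polynomial f \<longleftrightarrow> (\<exists>(a :: int \<Rightarrow> complex) (N :: nat).
     \<forall>z\<in>sphere 0 1. f z = (\<Sum>k = - int N..int N. a k * z powi k))"

definition weak_limit :: "(nat \<Rightarrow> complex measure) \<Rightarrow> complex measure \<Rightarrow> bool" where
  "weak_limit M \<mu> \<longleftrightarrow> sets \<mu> = sets circle_borel \<and> prob_space \<mu> \<and>
     (\<forall>f :: complex \<Rightarrow> real. continuous_on (sphere 0 1) f \<longrightarrow>
        (\<lambda>k. \<integral>z. f z \<partial>M k) \<longlonglongrightarrow> (\<integral>z. f z \<partial>\<mu>))"

text \<open>Sequences are indexed from \<open>0\<close>, so \<open>Q j\<close> is the \<open>(j + 1)\<close>-st factor. For a strictly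
  increasing \<open>i\<close>, \<open>partial_product (\<lambda>j. Q (i j)) k\<close> is the measure with density
  the squared modulus of the product of the first \<open>k\<close> selected factors.\<close>

definition partial_product :: "(nat \<Rightarrow> complex \<Rightarrow> complex) \<Rightarrow> nat \<Rightarrow> complex measure" where
  "partial_product Q k = density circle_measure (\<lambda>z. ennreal ((cmod (\<Prod>j<k. Q j z))\<^sup>2))"

text \<open>A finite sequence \<open>i\<^sub>1 < \<dots> < i\<^sub>k\<close> is encoded by the finite set of its terms.\<close>

definition defines_generalized_Riesz_product :: "(nat \<Rightarrow> complex \<Rightarrow> complex) \<Rightarrow> bool" where
  "defines_generalized_Riesz_product Q \<longleftrightarrow>
     (\<forall>j. trig_polynomial (Q j)) \<and>
     (\<forall>I. finite I \<and> I \<noteq> {} \<longrightarrow> (\<integral>z. (cmod (\<Prod>i\<in>I. Q i z))\<^sup>2 \<partial>circle_measure) = 1) \<and>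
     (\<forall>i :: nat \<Rightarrow> nat. strict_mono i \<longrightarrow> (\<exists>\<nu>. weak_limit (partial_product (\<lambda>j. Q (i j))) \<nu>))"

definition generalized_Riesz_product ::
    "(nat \<Rightarrow> complex \<Rightarrow> complex) \<Rightarrow> complex measure \<Rightarrow> bool" where
  "generalized_Riesz_product Q \<mu> \<longleftrightarrow>
     defines_generalized_Riesz_product Q \<and> weak_limit (partial_product Q) \<mu>"

text \<open>\<open>A\<close> is the part of \<open>N\<close> absolutely continuous with respect to \<open>M\<close>, i.e.\ \<open>N\<close> is the sum of
  \<open>A\<close> and a measure \<open>S\<close> carried by an \<open>M\<close>-null set.\<close>

definition abs_cont_part :: "'a measure \<Rightarrow> 'a measure \<Rightarrow> 'a measure \<Rightarrow> bool" where
  "abs_cont_part M N A \<longleftrightarrow> sets A = sets M \<and> absolutely_continuous M A \<and>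
     (\<exists>S. sets S = sets M \<and> (\<exists>Z\<in>null_sets M. emeasure S (space M - Z) = 0) \<and>
          (\<forall>B\<in>sets M. emeasure N B = emeasure A B + emeasure S B))"

definition log_ennreal :: "ennreal \<Rightarrow> ereal" where
  "log_ennreal x = (if x = 0 then - \<infinity> else if x = \<infinity> then \<infinity> else ereal (ln (enn2real x)))"

text \<open>The integral of an extended-real function as the integral of the positive part minus that of
  the negative part; it is meaningful unless both are infinite. This does not happen for the
  logarithm of a nonnegative integrable function, whose positive part is integrable.\<close>

definition ext_integral :: "'a measure \<Rightarrow> ('a \<Rightarrow> ereal) \<Rightarrow> ereal" where
  "ext_integral M f =
     enn2ereal (\<integral>\<^sup>+ x. e2ennreal (f x) \<partial>M) - enn2ereal (\<integral>\<^sup>+ x. e2ennreal (- f x) \<partial>M)"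

end

theory Submission
  imports Defs
begin

text \<open>Let \<open>p\<^sub>n = |P\<^sub>0 \<cdots> P\<^sub>n\<^sub>-\<^sub>1|\<^sup>2\<close>, let \<open>f\<close> be the density of the absolutely continuous part of \<open>\<mu>\<close>, and write
  \<open>L\<^sub>n\<close> for the integral of \<open>log p\<^sub>n\<close> and \<open>I\<close> for that of \<open>log f\<close>. The theorem follows from \<open>I \<le> L\<^sub>n\<close> for
  every \<open>n\<close> and \<open>limsup L\<^sub>n \<le> I\<close>; the case \<open>n = 0\<close> of the first inequality is \<open>I \<le> 0\<close>. Both rest on
  \<open>log x \<le> x - 1\<close>.

  The first inequality uses the product structure. The factors from \<open>P\<^sub>n\<close> on define a generalized
  Riesz product \<open>\<nu>\<close> of their own, and \<open>\<mu> = p\<^sub>n \<nu>\<close> because \<open>p\<^sub>n\<close> is continuous (\<open>weak_limit_tail\<close>). Hence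
  \<open>f / p\<^sub>n\<close> has integral at most \<open>1\<close>, and the integral of \<open>log f - log p\<^sub>n\<close> is at most \<open>0\<close>
  (\<open>ext_integral_log_ac_part_le\<close>).

  The second inequality is the lower semicontinuity of relative entropy: \<open>- L\<^sub>n\<close> is the entropy of \<open>dz\<close>
  relative to \<open>p\<^sub>n dz\<close>, and \<open>- I\<close> is that of \<open>dz\<close> relative to \<open>\<mu>\<close>. For a positive continuous \<open>\<phi>\<close>,
  the integral of \<open>\<phi> p\<^sub>n - 1 - log \<phi>\<close> bounds \<open>L\<^sub>n\<close> from above, and this bound passes to the
  weak limit. It extends to bounded measurable \<open>\<phi>\<close> because continuous functions are
  dense in \<open>L\<^sup>1\<close> (\<open>limsup_log_le_measurable\<close>). The best choice is \<open>1 / f\<close>, set to \<open>0\<close> on the null set that carries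
  the singular part; truncations of it give the bound \<open>I\<close> in the limit
  (\<open>limsup_le_ext_integral_log_ac_part\<close>).\<close>

section \<open>Density of continuous functions\<close>

text \<open>The sum of two measures serves to approximate a function by continuous ones with respect to both
  of them at once.\<close>

definition sum_measure :: "'a measure \<Rightarrow> 'a measure \<Rightarrow> 'a measure" where
  "sum_measure M N = measure_of (space M) (sets M) (\<lambda>A. emeasure M A + emeasure N A)"

lemma sets_sum_measure [simp, measurable_cong]: "sets (sum_measure M N) = sets M"
  by (simp add: sum_measure_def)

lemma space_sum_measure [simp]: "space (sum_measure M N) = space M"
  by (simp add: sum_measure_def)

lemma emeasure_sum_measure:
  assumes "sets N = sets M" and "A \<in> sets M"
  shows "emeasure (sum_measure M N) A = emeasure M A + emeasure N A"
proof -
  have "countably_additive (sets M) (\<lambda>A. emeasure M A + emeasure N A)"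
  proof (rule countably_additiveI)
    fix A :: "nat \<Rightarrow> 'a set"
    assume A: "range A \<subseteq> sets M" "disjoint_family A"
    then show "(\<Sum>i. emeasure M (A i) + emeasure N (A i))
        = emeasure M (\<Union> (range A)) + emeasure N (\<Union> (range A))"
      using assms(1) by (subst suminf_add[symmetric]) (simp_all add: suminf_emeasure)
  qed
  then show ?thesis
    using assms(2) by (intro emeasure_measure_of[OF sum_measure_def])
      (auto simp: positive_def dest: sets.sets_into_space)
qed

lemma finite_measure_sum_measure:
  assumes "sets N = sets M" "finite_measure M" "finite_measure N"
  shows "finite_measure (sum_measure M N)"
proof (rule finite_measureI)
  have "space N = space M"
    using assms(1) by (rule sets_eq_imp_space_eq)
  then show "emeasure (sum_measure M N) (space (sum_measure M N)) \<noteq> \<infinity>"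
    using emeasure_sum_measure[OF assms(1) sets.top]
      finite_measure.emeasure_finite[OF assms(2)] finite_measure.emeasure_finite[OF assms(3)]
    by simp
qed

lemma le_sum_measure:
  assumes "sets N = sets M"
  shows "M \<le> sum_measure M N" "N \<le> sum_measure M N"
proof -
  show "M \<le> sum_measure M N"
    by (subst le_measure) (auto simp: le_fun_def emeasure_sum_measure[OF assms] emeasure_notin_sets)
  show "N \<le> sum_measure M N"
    using assms by (subst le_measure) (auto simp: le_fun_def emeasure_sum_measure[OF assms] emeasure_notin_sets)
qed

text \<open>For nonempty \<open>K\<close>, the functions \<open>max 0 (1 - k d(x, K))\<close> decrease to the indicator of \<open>K\<close>.\<close>

lemma indicator_closed_approx:
  fixes K :: "'a::metric_space set"
  assumes "closed K"
  obtains \<phi> :: "nat \<Rightarrow> 'a \<Rightarrow> real"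
  where "\<And>k. continuous_on UNIV (\<phi> k)" "\<And>k x. \<bar>\<phi> k x\<bar> \<le> 1" "\<And>x. (\<lambda>k. \<phi> k x) \<longlonglongrightarrow> indicator K x"
proof (cases "K = {}")
  case True
  show ?thesis
    by (rule that[of "\<lambda>_ _. 0"]) (auto simp: True)
next
  case False
  define \<phi> where "\<phi> k x = max 0 (1 - real k * infdist x K)" for k x
  show ?thesis
  proof (rule that[of \<phi>])
    show "continuous_on UNIV (\<phi> k)" for k
      unfolding \<phi>_def by (intro continuous_intros)
    show "\<bar>\<phi> k x\<bar> \<le> 1" for k x
      by (auto simp: \<phi>_def infdist_nonneg)
    show "(\<lambda>k. \<phi> k x) \<longlonglongrightarrow> indicator K x" for x
    proof (cases "x \<in> K")
      case True
      then show ?thesis by (simp add: \<phi>_def)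
    next
      case x: False
      then have pos: "infdist x K > 0"
        using assms False by (metis in_closed_iff_infdist_zero infdist_nonneg order_le_less)
      obtain n where n: "1 / infdist x K < real n"
        using reals_Archimedean2 by blast
      have "\<phi> k x = 0" if "k \<ge> n" for k
      proof -
        have "1 / infdist x K < real k" using n that by linarith
        then show ?thesis using pos by (simp add: \<phi>_def field_simps)
      qed
      then show ?thesis
        using x by (intro tendsto_eventually) (auto simp: eventually_at_top_linorder)
    qed
  qed
qed

lemma tendsto_L1_dominated:
  fixes f :: "'a \<Rightarrow> real"
  assumes [measurable]: "\<And>i. s i \<in> borel_measurable M" "f \<in> borel_measurable M"
    and lim: "\<And>x. x \<in> space M \<Longrightarrow> (\<lambda>i. s i x) \<longlonglongrightarrow> f x"
    and bound: "\<And>i x. x \<in> space M \<Longrightarrow> \<bar>s i x\<bar> \<le> w x" and w: "integrable M w"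
  shows "(\<lambda>i. \<integral>x. \<bar>s i x - f x\<bar> \<partial>M) \<longlonglongrightarrow> 0"
proof -
  have "\<bar>f x\<bar> \<le> w x" if "x \<in> space M" for x
    using tendsto_rabs[OF lim[OF that]] bound[OF that]
    by (intro tendsto_upperbound[OF _ always_eventually]) auto
  then have b: "\<bar>\<bar>s i x - f x\<bar>\<bar> \<le> 2 * w x" if "x \<in> space M" for i x
    using bound[OF that, of i] that by fastforce
  have "(\<lambda>i. \<integral>x. \<bar>s i x - f x\<bar> \<partial>M) \<longlonglongrightarrow> (\<integral>x. 0 \<partial>M)"
  proof (rule integral_dominated_convergence[where w = "\<lambda>x. 2 * w x"])
    show "AE x in M. (\<lambda>i. \<bar>s i x - f x\<bar>) \<longlonglongrightarrow> 0"
      by (intro AE_I2 tendsto_rabs_zero LIM_zero lim)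
  qed (use b w in auto)
  then show ?thesis by simp
qed

text \<open>The functions that are \<open>L\<^sup>1\<close>-limits of continuous ones form a linear space closed under \<open>L\<^sup>1\<close>-limits,
  so only indicators have to be treated. For compact sets the preceding lemma and dominated
  convergence apply; an arbitrary Borel set is reached from inside by compact sets, because finite
  Borel measures are regular.\<close>

lemma continuous_dense_L1:
  fixes M :: "'a::{second_countable_topology, complete_space} measure" and f :: "'a \<Rightarrow> real"
  assumes fin: "finite_measure M" and sets: "sets M = sets borel"
    and f: "integrable M f" and "e > 0"
  obtains \<phi> where "continuous_on UNIV \<phi>" "integrable M \<phi>" "(\<integral>x. \<bar>\<phi> x - f x\<bar> \<partial>M) < e"
proof -
  interpret finite_measure M by fact
  note sets[measurable_cong]
  define appr where "appr f \<longleftrightarrow> (\<forall>e>0. \<exists>\<phi>. continuous_on UNIV \<phi> \<and> integrable M \<phi> \<and>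
    (\<integral>x. \<bar>\<phi> x - f x\<bar> \<partial>M) < e)" for f :: "'a \<Rightarrow> real"
  have apprD: "\<exists>\<phi>. continuous_on UNIV \<phi> \<and> integrable M \<phi> \<and> (\<integral>x. \<bar>\<phi> x - f x\<bar> \<partial>M) < e"
    if "appr f" "e > 0" for f e
    using that unfolding appr_def by simp
  have cont: "appr \<phi>" if "continuous_on UNIV \<phi>" "integrable M \<phi>" for \<phi>
    unfolding appr_def using that by force
  have closed: "appr f" if f: "integrable M f" and s: "\<And>i. integrable M (s i)" "\<And>i. appr (s i)"
    and lim: "(\<lambda>i::nat. \<integral>x. \<bar>s i x - f x\<bar> \<partial>M) \<longlonglongrightarrow> 0" for f s
    unfolding appr_def
  proof (intro allI impI)
    fix e :: real assume "e > 0"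
    then have "eventually (\<lambda>i. (\<integral>x. \<bar>s i x - f x\<bar> \<partial>M) < e / 2) sequentially"
      by (intro order_tendstoD(2)[OF lim]) simp
    then obtain i where i: "(\<integral>x. \<bar>s i x - f x\<bar> \<partial>M) < e / 2"
      by (auto dest: eventually_happens)
    obtain \<phi> where \<phi>: "continuous_on UNIV \<phi>" "integrable M \<phi>" "(\<integral>x. \<bar>\<phi> x - s i x\<bar> \<partial>M) < e / 2"
      using s(2)[of i] \<open>e > 0\<close> unfolding appr_def by (meson half_gt_zero)
    have "(\<integral>x. \<bar>\<phi> x - f x\<bar> \<partial>M) \<le> (\<integral>x. \<bar>\<phi> x - s i x\<bar> + \<bar>s i x - f x\<bar> \<partial>M)"
      using f s(1)[of i] \<phi> by (intro integral_mono) auto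
    also have "\<dots> < e"
      using f s(1)[of i] \<phi> i by (subst Bochner_Integration.integral_add) auto
    finally show "\<exists>\<phi>. continuous_on UNIV \<phi> \<and> integrable M \<phi> \<and> (\<integral>x. \<bar>\<phi> x - f x\<bar> \<partial>M) < e"
      using \<phi> by blast
  qed
  have "appr f"
    using f
  proof (induction rule: integrable_induct)
    case (base A c)
    have compact: "appr (\<lambda>x. indicator K x *\<^sub>R c)" if K: "compact K" for K
    proof -
      obtain \<phi> :: "nat \<Rightarrow> 'a \<Rightarrow> real" where \<phi>: "\<And>k. continuous_on UNIV (\<phi> k)"
        "\<And>k x. \<bar>\<phi> k x\<bar> \<le> 1" "\<And>x. (\<lambda>k. \<phi> k x) \<longlonglongrightarrow> indicator K x"
        by (rule indicator_closed_approx[OF compact_imp_closed[OF K]]) (rule that)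
      have [measurable]: "\<phi> k \<in> borel_measurable borel" "K \<in> sets borel" for k
        using \<phi>(1) K by (auto intro: borel_measurable_continuous_onI borel_compact)
      have bound: "\<bar>\<phi> k x *\<^sub>R c\<bar> \<le> \<bar>c\<bar>" for k x
        using mult_right_mono[OF \<phi>(2)[of k x] abs_ge_zero[of c]] by (simp add: abs_mult)
      have int: "integrable M (\<lambda>x. \<phi> k x *\<^sub>R c)" for k
        using bound[of k] by (intro integrable_const_bound[where B = "\<bar>c\<bar>"] AE_I2) simp_all
      show ?thesis
      proof (rule closed[where s = "\<lambda>k x. \<phi> k x *\<^sub>R c"])
        show "integrable M (\<lambda>x. indicator K x *\<^sub>R c)"
          by (intro integrable_const_bound[where B = "\<bar>c\<bar>"]) (auto simp: indicator_def)
        show "appr (\<lambda>x. \<phi> k x *\<^sub>R c)" for k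
          using \<phi>(1) int by (intro cont) (auto intro!: continuous_intros)
        show "(\<lambda>i. \<integral>x. \<bar>\<phi> i x *\<^sub>R c - indicat_real K x *\<^sub>R c\<bar> \<partial>M) \<longlonglongrightarrow> 0"
          by (rule tendsto_L1_dominated[where w = "\<lambda>_. \<bar>c\<bar>"])
            (use bound in \<open>auto intro: tendsto_mult_right \<phi>(3)\<close>)
      qed (rule int)
    qed
    have [measurable]: "A \<in> sets borel"
      using base sets by auto
    have reg: "emeasure M A = (SUP K \<in> {K. K \<subseteq> A \<and> compact K}. emeasure M K)"
      by (intro inner_regular sets) auto
    have "\<exists>K. K \<subseteq> A \<and> compact K \<and> measure M A < measure M K + 1 / real (Suc n)" for n
    proof (rule ccontr)
      assume *: "\<not> ?thesis"
      have "emeasure M K \<le> ennreal (measure M A - 1 / real (Suc n))" if "K \<subseteq> A" "compact K" for K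
      proof -
        have "measure M K \<le> measure M A - 1 / real (Suc n)"
          using * that by (auto simp: not_less)
        then show ?thesis
          unfolding emeasure_eq_measure by (rule ennreal_leI)
      qed
      then have "emeasure M A \<le> ennreal (measure M A - 1 / real (Suc n))"
        unfolding reg by (intro SUP_least) auto
      moreover have "0 \<le> measure M A - 1 / real (Suc n)"
      proof -
        have "\<not> measure M A < measure M {} + 1 / real (Suc n)"
          using * compact_empty empty_subsetI by blast
        then show ?thesis by (simp del: of_nat_Suc)
      qed
      ultimately have "measure M A \<le> measure M A - 1 / real (Suc n)"
        unfolding emeasure_eq_measure by (subst (asm) (1) ennreal_le_iff) auto
      then show False
        by (simp add: field_simps)
    qed
    then obtain K where K: "\<And>n. K n \<subseteq> A" "\<And>n. compact (K n)"
        "\<And>n. measure M A < measure M (K n) + 1 / real (Suc n)"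
      by metis
    have [measurable]: "K n \<in> sets borel" for n
      using K(2) by (rule borel_compact)
    show ?case
    proof (rule closed[where s = "\<lambda>n x. indicator (K n) x *\<^sub>R c"])
      show "integrable M (\<lambda>x. indicator A x *\<^sub>R c)"
           "integrable M (\<lambda>x. indicator (K n) x *\<^sub>R c)" for n
        by (intro integrable_const_bound[where B = "\<bar>c\<bar>"]; auto simp: indicator_def)+
      have eq: "(\<integral>x. \<bar>indicat_real (K n) x *\<^sub>R c - indicat_real A x *\<^sub>R c\<bar> \<partial>M) = \<bar>c\<bar> * (measure M A - measure M (K n))" for n
      proof -
        have "(\<integral>x. \<bar>indicat_real (K n) x *\<^sub>R c - indicat_real A x *\<^sub>R c\<bar> \<partial>M) = (\<integral>x. \<bar>c\<bar> * indicat_real (A - K n) x \<partial>M)"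
          using K(1)[of n] by (intro Bochner_Integration.integral_cong) (auto simp: indicator_def)
        then show ?thesis
          using K(1)[of n] by (simp add: finite_measure_Diff)
      qed
      have to0: "(\<lambda>n. \<bar>c\<bar> * (1 / real (Suc n))) \<longlonglongrightarrow> \<bar>c\<bar> * 0"
        by (intro tendsto_mult tendsto_const LIMSEQ_Suc[OF lim_1_over_n])
      show "(\<lambda>n. \<integral>x. \<bar>indicat_real (K n) x *\<^sub>R c - indicat_real A x *\<^sub>R c\<bar> \<partial>M) \<longlonglongrightarrow> 0"
        unfolding eq
      proof (rule tendsto_sandwich[OF _ _ tendsto_const])
        show "(\<lambda>n. \<bar>c\<bar> * (1 / real (Suc n))) \<longlonglongrightarrow> 0"
          using to0 by simp
        have "measure M (K n) \<le> measure M A" "measure M A - measure M (K n) \<le> 1 / real (Suc n)" for n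
          using finite_measure_mono[OF K(1)[of n]] K(3)[of n] by auto
        then show "\<forall>\<^sub>F n in sequentially. 0 \<le> \<bar>c\<bar> * (measure M A - measure M (K n))"
          "\<forall>\<^sub>F n in sequentially. \<bar>c\<bar> * (measure M A - measure M (K n)) \<le> \<bar>c\<bar> * (1 / real (Suc n))"
          by (intro always_eventually allI mult_nonneg_nonneg mult_left_mono; simp del: of_nat_Suc)+
      qed
    qed (rule compact[OF K(2)])
  next
    case (add f g)
    show ?case
      unfolding appr_def
    proof (intro allI impI)
      fix e :: real assume "e > 0"
      then obtain \<phi> \<psi> where \<phi>: "continuous_on UNIV \<phi>" "integrable M \<phi>" "(\<integral>x. \<bar>\<phi> x - f x\<bar> \<partial>M) < e / 2"
        and \<psi>: "continuous_on UNIV \<psi>" "integrable M \<psi>" "(\<integral>x. \<bar>\<psi> x - g x\<bar> \<partial>M) < e / 2"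
        using apprD[OF add.IH(1) half_gt_zero] apprD[OF add.IH(2) half_gt_zero] by blast
      have "(\<integral>x. \<bar>\<phi> x + \<psi> x - (f x + g x)\<bar> \<partial>M) \<le> (\<integral>x. \<bar>\<phi> x - f x\<bar> + \<bar>\<psi> x - g x\<bar> \<partial>M)"
        using add.hyps \<phi> \<psi> by (intro integral_mono) auto
      also have "\<dots> < e"
        using add.hyps \<phi> \<psi> by (subst Bochner_Integration.integral_add) auto
      finally show "\<exists>\<phi>. continuous_on UNIV \<phi> \<and> integrable M \<phi> \<and> (\<integral>x. \<bar>\<phi> x - (f x + g x)\<bar> \<partial>M) < e"
        using \<phi> \<psi> by (intro exI[of _ "\<lambda>x. \<phi> x + \<psi> x"]) (auto intro!: continuous_intros)
    qed
  next
    case (lim f s)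
    show ?case
    proof (rule closed[where s = s])
      show "(\<lambda>i. \<integral>x. \<bar>s i x - f x\<bar> \<partial>M) \<longlonglongrightarrow> 0"
        using lim.hyps by (intro tendsto_L1_dominated[where w = "\<lambda>x. 2 * \<bar>f x\<bar>"]) simp_all
    qed (fact lim.hyps lim.IH)+
  qed
  from apprD[OF this \<open>e > 0\<close>] show ?thesis
    using that by blast
qed

lemma space_circle_borel [simp]: "space circle_borel = sphere 0 1"
  by (simp add: space_restrict_space)

lemma integrable_between:
  fixes h :: "'a \<Rightarrow> real"
  assumes "finite_measure M" "h \<in> borel_measurable M" "\<And>x. x \<in> space M \<Longrightarrow> a \<le> h x \<and> h x \<le> b"
  shows "integrable M h"
proof (rule finite_measure.integrable_const_bound[OF assms(1)])
  show "AE x in M. norm (h x) \<le> max \<bar>a\<bar> \<bar>b\<bar>"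
    using assms(3) by (intro AE_I2) fastforce
qed (rule assms(2))

text \<open>Approximation in \<open>L\<^sup>1\<close> of the sum of the two measures, transported to the plane; clamping the
  approximants between the bounds of \<open>g\<close> only brings them closer to \<open>g\<close>.\<close>

lemma circle_continuous_approx:
  fixes g :: "complex \<Rightarrow> real"
  assumes M: "finite_measure M" "sets M = sets circle_borel"
    and N: "finite_measure N" "sets N = sets circle_borel"
    and g: "g \<in> borel_measurable circle_borel"
    and bounds: "\<And>z. z \<in> sphere 0 1 \<Longrightarrow> a \<le> g z \<and> g z \<le> b" and "a \<le> b"
  obtains \<phi> :: "nat \<Rightarrow> complex \<Rightarrow> real"
  where "\<And>k. continuous_on UNIV (\<phi> k)" "\<And>k z. a \<le> \<phi> k z \<and> \<phi> k z \<le> b"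
    "(\<lambda>k. \<integral>z. \<bar>\<phi> k z - g z\<bar> \<partial>M) \<longlonglongrightarrow> 0" "(\<lambda>k. \<integral>z. \<bar>\<phi> k z - g z\<bar> \<partial>N) \<longlonglongrightarrow> 0"
proof -
  define S where "S = sum_measure M N"
  define T where "T = distr S borel (\<lambda>z. z)"
  define G where "G z = (if z \<in> sphere 0 1 then g z else a)" for z
  have sets_S: "sets S = sets circle_borel"
    using M by (simp add: S_def)
  have space_eq: "space S = sphere 0 1" "space M = sphere 0 1" "space N = sphere 0 1"
    using sets_eq_imp_space_eq[OF sets_S] sets_eq_imp_space_eq[OF M(2)] sets_eq_imp_space_eq[OF N(2)]
    by simp_all
  have id: "(\<lambda>z. z) \<in> borel_measurable S"
    unfolding measurable_cong_sets[OF sets_S refl] by (rule measurable_restrict_space1) simp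
  have "finite_measure S"
    unfolding S_def using M N by (intro finite_measure_sum_measure) simp_all
  then have T: "finite_measure T"
    unfolding T_def using id by (rule finite_measure.finite_measure_distr)
  interpret T: finite_measure T by fact
  have sets_T [measurable_cong]: "sets T = sets borel"
    by (simp add: T_def)
  have G [measurable]: "G \<in> borel_measurable borel"
    unfolding G_def using g by (subst (asm) measurable_restrict_space_iff[where c = a]) auto
  have G_bounds: "a \<le> G z \<and> G z \<le> b" for z
    using bounds \<open>a \<le> b\<close> by (auto simp: G_def)
  have "integrable T G"
    using G_bounds by (intro integrable_between[OF T]) auto
  then have "\<exists>\<psi>. continuous_on UNIV \<psi> \<and> integrable T \<psi> \<and> (\<integral>z. \<bar>\<psi> z - G z\<bar> \<partial>T) < 1 / real (Suc k)" for k
    by (rule continuous_dense_L1[OF T sets_T, of _ "1 / real (Suc k)"]) auto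
  then obtain \<psi> where \<psi>: "\<And>k. continuous_on UNIV (\<psi> k)" "\<And>k. integrable T (\<psi> k)"
      "\<And>k. (\<integral>z. \<bar>\<psi> k z - G z\<bar> \<partial>T) < 1 / real (Suc k)"
    by metis
  define \<phi> where "\<phi> k z = max a (min b (\<psi> k z))" for k z
  have cont: "continuous_on UNIV (\<phi> k)" for k
    unfolding \<phi>_def by (intro continuous_intros \<psi>(1))
  have [measurable]: "\<phi> k \<in> borel_measurable borel" for k
    using cont by (rule borel_measurable_continuous_onI)
  have \<phi>_bounds: "a \<le> \<phi> k z \<and> \<phi> k z \<le> b" for k z
    using \<open>a \<le> b\<close> by (auto simp: \<phi>_def)
  have int: "integrable T (\<lambda>z. \<bar>\<phi> k z - G z\<bar>)" for k
    using integrable_between[OF T, of "\<phi> k" a b] \<phi>_bounds \<open>integrable T G\<close> by auto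
  have small: "(\<integral>z. \<bar>\<phi> k z - G z\<bar> \<partial>T) \<le> 1 / real (Suc k)" for k
  proof -
    have "(\<integral>z. \<bar>\<phi> k z - G z\<bar> \<partial>T) \<le> (\<integral>z. \<bar>\<psi> k z - G z\<bar> \<partial>T)"
    proof (rule integral_mono[OF int])
      show "integrable T (\<lambda>z. \<bar>\<psi> k z - G z\<bar>)"
        using \<psi>(2) \<open>integrable T G\<close> by auto
      show "\<bar>\<phi> k z - G z\<bar> \<le> \<bar>\<psi> k z - G z\<bar>" for z
        using G_bounds[of z] unfolding \<phi>_def by arith
    qed
    then show ?thesis using \<psi>(3)[of k] by simp
  qed
  have lim: "(\<lambda>k. \<integral>z. \<bar>\<phi> k z - g z\<bar> \<partial>X) \<longlonglongrightarrow> 0"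
    if X: "X \<le> S" "sets X = sets circle_borel" "space X = sphere 0 1" for X
  proof (rule tendsto_sandwich[OF _ _ tendsto_const LIMSEQ_Suc[OF lim_1_over_n]])
    have "(\<integral>z. \<bar>\<phi> k z - g z\<bar> \<partial>X) \<le> 1 / real (Suc k)" for k
    proof (rule integral_real_bounded)
      have "(\<integral>\<^sup>+z. ennreal \<bar>\<phi> k z - g z\<bar> \<partial>X) \<le> (\<integral>\<^sup>+z. ennreal \<bar>\<phi> k z - g z\<bar> \<partial>S)"
        using X sets_S by (intro nn_integral_mono_measure) simp_all
      also have "\<dots> = (\<integral>\<^sup>+z. ennreal \<bar>\<phi> k z - G z\<bar> \<partial>S)"
        by (intro nn_integral_cong) (simp add: G_def space_eq)
      also have "\<dots> = (\<integral>\<^sup>+z. ennreal \<bar>\<phi> k z - G z\<bar> \<partial>T)"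
        unfolding T_def using id by (subst nn_integral_distr) auto
      also have "\<dots> = ennreal (\<integral>z. \<bar>\<phi> k z - G z\<bar> \<partial>T)"
        using int by (intro nn_integral_eq_integral) auto
      also have "\<dots> \<le> ennreal (1 / real (Suc k))"
        by (intro ennreal_leI small)
      finally show "(\<integral>\<^sup>+z. ennreal \<bar>\<phi> k z - g z\<bar> \<partial>X) \<le> ennreal (1 / real (Suc k))" .
    qed simp
    then show "\<forall>\<^sub>F k in sequentially. (\<integral>z. \<bar>\<phi> k z - g z\<bar> \<partial>X) \<le> 1 / real (Suc k)"
      by simp
  qed simp
  show ?thesis
    using cont \<phi>_bounds
  proof (rule that)
    show "(\<lambda>k. \<integral>z. \<bar>\<phi> k z - g z\<bar> \<partial>M) \<longlonglongrightarrow> 0" "(\<lambda>k. \<integral>z. \<bar>\<phi> k z - g z\<bar> \<partial>N) \<longlonglongrightarrow> 0"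
      using M(2) N(2) le_sum_measure[of N M] by (auto intro!: lim simp: S_def space_eq)
  qed
qed

lemma tendsto_integral_L1:
  fixes g :: "'a \<Rightarrow> real"
  assumes "\<And>k. integrable M (\<phi> k)" "integrable M g"
    and lim: "(\<lambda>k. \<integral>z. \<bar>\<phi> k z - g z\<bar> \<partial>M) \<longlonglongrightarrow> 0"
  shows "(\<lambda>k. \<integral>z. \<phi> k z \<partial>M) \<longlonglongrightarrow> (\<integral>z. g z \<partial>M)"
proof -
  have "\<bar>(\<integral>z. \<phi> k z \<partial>M) - (\<integral>z. g z \<partial>M)\<bar> \<le> (\<integral>z. \<bar>\<phi> k z - g z\<bar> \<partial>M)" for k
    using assms(1)[of k] assms(2) integral_abs_bound[of M "\<lambda>z. \<phi> k z - g z"] by simp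
  then have "(\<lambda>k. (\<integral>z. \<phi> k z \<partial>M) - (\<integral>z. g z \<partial>M)) \<longlonglongrightarrow> 0"
    by (intro tendsto_rabs_zero_cancel[OF tendsto_sandwich[OF _ _ tendsto_const lim]]) auto
  then show ?thesis
    by (rule LIM_zero_cancel)
qed

lemma circle_measure_eqI_continuous:
  assumes M: "finite_measure M" "sets M = sets circle_borel"
    and N: "finite_measure N" "sets N = sets circle_borel"
    and eq: "\<And>\<phi> :: complex \<Rightarrow> real. continuous_on (sphere 0 1) \<phi> \<Longrightarrow> (\<integral>z. \<phi> z \<partial>M) = (\<integral>z. \<phi> z \<partial>N)"
  shows "M = N"
proof (rule measure_eqI)
  fix A assume A: "A \<in> sets M"
  interpret M: finite_measure M by fact
  interpret N: finite_measure N by fact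
  have [measurable]: "(indicator A :: complex \<Rightarrow> real) \<in> borel_measurable circle_borel"
    using A M(2) by simp
  obtain \<phi> :: "nat \<Rightarrow> complex \<Rightarrow> real" where \<phi>: "\<And>k. continuous_on UNIV (\<phi> k)"
    "\<And>k z. 0 \<le> \<phi> k z \<and> \<phi> k z \<le> 1"
    "(\<lambda>k. \<integral>z. \<bar>\<phi> k z - indicator A z\<bar> \<partial>M) \<longlonglongrightarrow> 0" "(\<lambda>k. \<integral>z. \<bar>\<phi> k z - indicator A z\<bar> \<partial>N) \<longlonglongrightarrow> 0"
    by (rule circle_continuous_approx[OF M N, of "indicator A" 0 1]) auto
  have meas: "\<phi> k \<in> borel_measurable circle_borel" for k
    using borel_measurable_continuous_onI[OF \<phi>(1)] by (rule measurable_restrict_space1)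
  have "integrable X (\<phi> k)" "integrable X (indicator A :: complex \<Rightarrow> real)"
    if "finite_measure X" "sets X = sets circle_borel" for X k
    using that \<phi>(2)[of k] A M(2) meas[of k] measurable_cong_sets[OF that(2) refl]
    by (intro finite_measure.integrable_const_bound[where B = 1]; auto simp: indicator_def)+
  then have "(\<lambda>k. \<integral>z. \<phi> k z \<partial>M) \<longlonglongrightarrow> (\<integral>z. indicator A z \<partial>M)"
    "(\<lambda>k. \<integral>z. \<phi> k z \<partial>N) \<longlonglongrightarrow> (\<integral>z. indicator A z \<partial>N)"
    using \<phi>(3,4) M N by (intro tendsto_integral_L1; simp)+
  moreover have "(\<integral>z. \<phi> k z \<partial>M) = (\<integral>z. \<phi> k z \<partial>N)" for k
    using \<phi>(1) continuous_on_subset by (intro eq) blast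
  ultimately have "(\<integral>z. indicator A z \<partial>M) = (\<integral>z. indicator A z \<partial>N :: real)"
    using LIMSEQ_unique by simp
  then show "emeasure M A = emeasure N A"
    using A M(2) N(2) by (simp add: M.emeasure_eq_measure N.emeasure_eq_measure)
qed (use M N in simp)

section \<open>Extended integrals of logarithms\<close>

lemma measurable_log_ennreal [measurable]: "log_ennreal \<in> borel_measurable borel"
  unfolding log_ennreal_def[abs_def] by measurable

lemma log_ennreal_ereal:
  "0 < x \<Longrightarrow> log_ennreal (ennreal x) = ereal (ln x)"
  by (simp add: log_ennreal_def)

text \<open>This crude bound makes the positive part of \<open>log f\<close> integrable as soon as \<open>f\<close> is.\<close>

lemma log_ennreal_le_self: "log_ennreal x \<le> enn2ereal x"
proof (cases x)
  case (real r)
  then show ?thesis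
    using ln_le_minus_one[of r] by (cases "r = 0") (auto simp: log_ennreal_def enn2ereal_ennreal)
qed (simp add: log_ennreal_def)

lemma ext_integral_mono_AE:
  assumes "AE x in M. f x \<le> g x"
  shows "ext_integral M f \<le> ext_integral M g"
  unfolding ext_integral_def
proof (intro ereal_minus_mono)
  show "enn2ereal (\<integral>\<^sup>+ x. e2ennreal (f x) \<partial>M) \<le> enn2ereal (\<integral>\<^sup>+ x. e2ennreal (g x) \<partial>M)"
    using assms by (auto simp flip: less_eq_ennreal.rep_eq intro!: nn_integral_mono_AE e2ennreal_mono elim: eventually_mono)
  show "enn2ereal (\<integral>\<^sup>+ x. e2ennreal (- g x) \<partial>M) \<le> enn2ereal (\<integral>\<^sup>+ x. e2ennreal (- f x) \<partial>M)"
    using assms by (auto simp flip: less_eq_ennreal.rep_eq intro!: nn_integral_mono_AE e2ennreal_mono elim: eventually_mono)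
qed

lemma ext_integral_eq_integral:
  assumes "integrable M h"
  shows "ext_integral M (\<lambda>x. ereal (h x)) = ereal (\<integral>x. h x \<partial>M)"
proof -
  have fin: "(\<integral>\<^sup>+x. ennreal (h x) \<partial>M) < \<infinity>" "(\<integral>\<^sup>+x. ennreal (- h x) \<partial>M) < \<infinity>"
    using assms by (auto simp: real_integrable_def top.not_eq_extremum)
  have ereal: "enn2ereal y = ereal (enn2real y)" if "y < \<infinity>" for y
    using that by (cases y) (auto simp: enn2ereal_ennreal)
  show ?thesis
    unfolding ext_integral_def real_lebesgue_integral_def[OF assms]
    by (simp add: ereal fin[simplified])
qed

text \<open>Both the positive and the negative part have a finite integral here, so \<open>F\<close> is almost everywhere
  finite. This confines extended arithmetic to the trivial case that the integral is \<open>- \<infinity>\<close>.\<close>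

lemma ext_integral_finiteD:
  assumes [measurable]: "F \<in> borel_measurable M"
    and pos: "(\<integral>\<^sup>+x. e2ennreal (F x) \<partial>M) < \<infinity>" and fin: "ext_integral M F \<noteq> - \<infinity>"
  obtains u where "integrable M u" "AE x in M. F x = ereal (u x)" "ext_integral M F = ereal (\<integral>x. u x \<partial>M)"
proof -
  define u where "u x = real_of_ereal (F x)" for x
  have [measurable]: "u \<in> borel_measurable M"
    unfolding u_def by measurable
  have neg: "(\<integral>\<^sup>+x. e2ennreal (- F x) \<partial>M) < \<infinity>"
    using pos fin by (cases "\<integral>\<^sup>+x. e2ennreal (F x) \<partial>M"; cases "\<integral>\<^sup>+x. e2ennreal (- F x) \<partial>M")
      (auto simp: ext_integral_def enn2ereal_ennreal)
  have "AE x in M. e2ennreal (F x) \<noteq> \<infinity>" "AE x in M. e2ennreal (- F x) \<noteq> \<infinity>"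
    using pos neg nn_integral_PInf_AE[of "\<lambda>x. e2ennreal (F x)" M]
      nn_integral_PInf_AE[of "\<lambda>x. e2ennreal (- F x)" M] by auto
  then have F: "AE x in M. F x = ereal (u x)"
  proof eventually_elim
    case (elim x)
    then show ?case by (cases "F x") (auto simp: u_def e2ennreal_infty)
  qed
  have "(\<integral>\<^sup>+x. ennreal (u x) \<partial>M) = (\<integral>\<^sup>+x. e2ennreal (F x) \<partial>M)"
    "(\<integral>\<^sup>+x. ennreal (- u x) \<partial>M) = (\<integral>\<^sup>+x. e2ennreal (- F x) \<partial>M)"
    using F by (auto intro!: nn_integral_cong_AE elim!: eventually_mono)
  then have int: "integrable M u"
    using pos neg by (auto simp: real_integrable_def)
  have "ext_integral M F = ext_integral M (\<lambda>x. ereal (u x))"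
    using F by (intro antisym ext_integral_mono_AE) (auto elim!: eventually_mono)
  then show ?thesis
    using that[OF int F] ext_integral_eq_integral[OF int] by simp
qed

text \<open>Since \<open>log (f / p) \<le> f / p - 1\<close>, the difference \<open>log p - log f\<close> is at least \<open>1 - f / p\<close>, whose
  integral is nonnegative.\<close>

lemma ext_integral_log_mono_quotient:
  assumes "prob_space M"
    and [measurable]: "f \<in> borel_measurable M" "p \<in> borel_measurable M"
    and nonneg: "\<And>x. x \<in> space M \<Longrightarrow> 0 \<le> p x"
    and f: "(\<integral>\<^sup>+x. f x \<partial>M) < \<infinity>"
    and quot: "(\<integral>\<^sup>+x. f x / ennreal (p x) \<partial>M) \<le> 1"
    and zero: "AE x in M. p x = 0 \<longrightarrow> f x = 0"
  shows "ext_integral M (\<lambda>x. log_ennreal (f x)) \<le> ext_integral M (\<lambda>x. log_ennreal (ennreal (p x)))"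
proof (cases "ext_integral M (\<lambda>x. log_ennreal (f x)) = - \<infinity>")
  case False
  interpret prob_space M by fact
  have "(\<integral>\<^sup>+x. e2ennreal (log_ennreal (f x)) \<partial>M) \<le> (\<integral>\<^sup>+x. f x \<partial>M)"
    using e2ennreal_mono[OF log_ennreal_le_self] by (intro nn_integral_mono) simp
  then obtain u where u: "integrable M u" "AE x in M. log_ennreal (f x) = ereal (u x)"
    "ext_integral M (\<lambda>x. log_ennreal (f x)) = ereal (\<integral>x. u x \<partial>M)"
    using f False by (elim ext_integral_finiteD[rotated 2]) auto
  define r where "r x = enn2real (f x / ennreal (p x))" for x
  have [measurable]: "r \<in> borel_measurable M"
    unfolding r_def by measurable
  have fin: "AE x in M. f x / ennreal (p x) \<noteq> \<infinity>"
    using quot by (intro nn_integral_PInf_AE) (auto simp: top_unique)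
  have nn_r: "(\<integral>\<^sup>+x. ennreal (r x) \<partial>M) \<le> 1"
  proof -
    have "(\<integral>\<^sup>+x. ennreal (r x) \<partial>M) = (\<integral>\<^sup>+x. f x / ennreal (p x) \<partial>M)"
      using fin by (intro nn_integral_cong_AE) (auto simp: r_def less_top elim!: eventually_mono)
    then show ?thesis using quot by simp
  qed
  have int_r: "integrable M r"
    using nn_r by (intro integrableI_nonneg) (auto simp: r_def intro: le_less_trans)
  have r_le: "(\<integral>x. r x \<partial>M) \<le> 1"
    using nn_r by (intro integral_real_bounded) auto
  have "ereal (\<integral>x. u x \<partial>M) \<le> ereal (\<integral>x. u x - (r x - 1) \<partial>M)"
    using u(1) int_r r_le by (simp add: prob_space)
  also have "\<dots> = ext_integral M (\<lambda>x. ereal (u x - (r x - 1)))"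
    using u(1) int_r by (intro ext_integral_eq_integral[symmetric]) auto
  also have "\<dots> \<le> ext_integral M (\<lambda>x. log_ennreal (ennreal (p x)))"
  proof (rule ext_integral_mono_AE)
    show "AE x in M. ereal (u x - (r x - 1)) \<le> log_ennreal (ennreal (p x))"
      using u(2) fin zero AE_space
    proof eventually_elim
      case (elim x)
      from elim(1) obtain c where c: "f x = ennreal c" "c > 0" "u x = ln c"
        by (cases "f x") (auto simp: log_ennreal_def split: if_splits)
      then have p: "p x > 0"
        using elim(3) nonneg[OF elim(4)] by (cases "p x = 0") auto
      then have r: "r x = c / p x"
        using c by (simp add: r_def divide_ennreal)
      have "ln (c / p x) \<le> c / p x - 1"
        using c p by (intro ln_le_minus_one) simp
      then show ?case
        using c p r by (simp add: log_ennreal_ereal ln_div)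
    qed
  qed
  finally show ?thesis
    using u(3) by simp
qed simp

text \<open>Truncating \<open>f\<close> to the interval from \<open>1 / (m + 1)\<close> to \<open>m + 1\<close> does not increase the positive part of
  \<open>log f\<close>, and the negative parts of the truncated logarithms increase to that of \<open>log f\<close>, so
  monotone convergence allows \<open>m\<close> to tend to infinity. The error term \<open>2 / (m + 1)\<close> is the one that
  the test functions in the proof of \<open>limsup_le_ext_integral_log_ac_part\<close> produce.\<close>

lemma le_ext_integral_log_of_truncations:
  fixes L :: ereal
  assumes "prob_space M" and [measurable]: "f \<in> borel_measurable M"
    and f: "(\<integral>\<^sup>+x. f x \<partial>M) < \<infinity>"
    and L: "\<And>m. L \<le> ereal (2 / Suc m + (\<integral>x. ln (max (1 / Suc m) (min (Suc m) (enn2real (f x)))) \<partial>M))"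
  shows "L \<le> ext_integral M (\<lambda>x. log_ennreal (f x))"
proof -
  interpret prob_space M by fact
  define c where "c m x = max (1 / real (Suc m)) (min (real (Suc m)) (enn2real (f x)))" for m x
  have [measurable]: "c m \<in> borel_measurable M" for m
    unfolding c_def by measurable
  have c_bounds: "1 / real (Suc m) \<le> c m x" "c m x \<le> real (Suc m)" for m x
  proof -
    have "1 / real (Suc m) \<le> 1" "1 \<le> real (Suc m)"
      by simp_all
    then show "1 / real (Suc m) \<le> c m x" "c m x \<le> real (Suc m)"
      unfolding c_def by linarith+
  qed
  have c_pos: "0 < c m x" for m x
    using c_bounds(1)[of m x] by (rule less_le_trans[rotated]) simp
  have fin: "AE x in M. f x \<noteq> \<infinity>"
    using f by (intro nn_integral_PInf_AE) auto
  define A where "A = (\<integral>\<^sup>+x. e2ennreal (log_ennreal (f x)) \<partial>M)"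
  define B where "B m = (\<integral>\<^sup>+x. ennreal (- ln (c m x)) \<partial>M)" for m
  have "A \<le> (\<integral>\<^sup>+x. f x \<partial>M)"
    unfolding A_def using e2ennreal_mono[OF log_ennreal_le_self] by (intro nn_integral_mono) simp
  then have A: "A < \<infinity>"
    using f by auto
  have le: "L \<le> ereal (2 / Suc m) + enn2ereal A - enn2ereal (B m)" for m
  proof -
    have "\<bar>ln (c m x)\<bar> \<le> ln (real (Suc m))" for x
      using c_bounds[of m x] c_pos[of m x] ln_mono[of "1 / real (Suc m)" "c m x"] by (simp add: ln_div abs_le_iff)
    then have "integrable M (\<lambda>x. ln (c m x))"
      by (intro integrable_const_bound[where B = "ln (real (Suc m))"]) auto
    then have "ereal (\<integral>x. ln (c m x) \<partial>M) = enn2ereal (\<integral>\<^sup>+x. ennreal (ln (c m x)) \<partial>M) - enn2ereal (B m)"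
      by (simp add: ext_integral_def B_def flip: ext_integral_eq_integral)
    also have "\<dots> \<le> enn2ereal A - enn2ereal (B m)"
    proof (intro ereal_minus_mono order_refl)
      have "(\<integral>\<^sup>+x. ennreal (ln (c m x)) \<partial>M) \<le> A"
        unfolding A_def
      proof (intro nn_integral_mono_AE)
        show "AE x in M. ennreal (ln (c m x)) \<le> e2ennreal (log_ennreal (f x))"
          using fin
        proof eventually_elim
          case (elim x)
          \<comment> \<open>Above \<open>1\<close> the truncation can only have lowered \<open>f x\<close>; otherwise the left-hand side vanishes.\<close>
          show ?case
          proof (cases "1 < c m x")
            case True
            then have "c m x \<le> enn2real (f x)" "1 < enn2real (f x)"
              by (auto simp: c_def max_def min_def field_simps split: if_splits)
            then show ?thesis
              using elim True by (cases "f x") (auto simp: log_ennreal_ereal intro!: ennreal_leI)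
          next
            case False
            then have "ln (c m x) \<le> 0"
              using c_pos[of m x] by simp
            then show ?thesis by (simp add: ennreal_neg)
          qed
        qed
      qed
      then show "enn2ereal (\<integral>\<^sup>+x. ennreal (ln (c m x)) \<partial>M) \<le> enn2ereal A"
        by (simp add: less_eq_ennreal.rep_eq)
    qed
    finally have "ereal (2 / Suc m) + ereal (\<integral>x. ln (c m x) \<partial>M) \<le> ereal (2 / Suc m) + (enn2ereal A - enn2ereal (B m))"
      by (rule add_left_mono)
    then show ?thesis
      using L[of m] by (simp add: c_def minus_ereal_def add.assoc)
  qed
  have "B \<longlonglongrightarrow> (\<integral>\<^sup>+x. e2ennreal (- log_ennreal (ennreal (enn2real (f x)))) \<partial>M)"
    unfolding B_def
  proof (rule nn_integral_LIMSEQ)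
    have "ennreal (- ln (c m x)) \<le> ennreal (- ln (c n x))" if "m \<le> n" for m n x
    proof (cases "c m x < 1")
      case True
      have "1 / real (Suc n) \<le> 1 / real (Suc m)"
        using that by (intro divide_left_mono) auto
      moreover have "1 / real (Suc m) \<le> 1" "1 \<le> real (Suc m)" "1 \<le> real (Suc n)"
        by simp_all
      ultimately have "c n x \<le> c m x"
        using True unfolding c_def max_def min_def by argo
      then show ?thesis
        using c_pos[of n x] by (intro ennreal_leI) simp
    next
      case False
      then have "- ln (c m x) \<le> 0"
        by simp
      then show ?thesis
        by (simp add: ennreal_neg)
    qed
    then show "incseq (\<lambda>m x. ennreal (- ln (c m x)))"
      by (auto simp: incseq_def le_fun_def)
    show "(\<lambda>m. ennreal (- ln (c m x))) \<longlonglongrightarrow> e2ennreal (- log_ennreal (ennreal (enn2real (f x))))" for x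
    proof (cases "enn2real (f x) = 0")
      case True
      then have "- ln (c m x) = ln (real (Suc m))" for m
        by (simp add: c_def ln_div)
      moreover have "(\<lambda>m. ennreal (ln (real (Suc m)))) \<longlonglongrightarrow> \<top>"
        unfolding ennreal_tendsto_top_eq_at_top
        by (intro filterlim_compose[OF ln_at_top] filterlim_compose[OF filterlim_real_sequentially filterlim_Suc])
      ultimately show ?thesis
        using True by (simp add: log_ennreal_def e2ennreal_infty)
    next
      case False
      define h where "h = enn2real (f x)"
      have h: "h > 0"
        using False enn2real_nonneg[of "f x"] unfolding h_def by linarith
      have "eventually (\<lambda>m. max h (1 / h) < real m) sequentially"
        by (rule eventually_compose_filterlim[OF eventually_gt_at_top filterlim_real_sequentially])
      then have "eventually (\<lambda>m. c m x = h) sequentially"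
      proof eventually_elim
        case (elim m)
        then have "1 / real (Suc m) < h" "h < real (Suc m)"
          using h by (auto simp: field_simps)
        then show ?case
          by (simp add: c_def flip: h_def)
      qed
      then show ?thesis
        using h by (intro tendsto_eventually) (auto simp: log_ennreal_ereal simp flip: h_def elim!: eventually_mono)
    qed
  qed simp
  \<comment> \<open>\<open>enn2real\<close> sends \<open>\<infinity>\<close> to \<open>0\<close>, so the pointwise limit is the right one only where \<open>f\<close> is finite.\<close>
  also have "(\<integral>\<^sup>+x. e2ennreal (- log_ennreal (ennreal (enn2real (f x)))) \<partial>M) = (\<integral>\<^sup>+x. e2ennreal (- log_ennreal (f x)) \<partial>M)"
    using fin by (intro nn_integral_cong_AE) (auto simp: less_top elim!: eventually_mono)
  finally have B_lim: "B \<longlonglongrightarrow> (\<integral>\<^sup>+x. e2ennreal (- log_ennreal (f x)) \<partial>M)" .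
  \<comment> \<open>The limit of the negative parts may be infinite; the difference is continuous there because
    \<open>A\<close> is finite.\<close>
  have A_real: "\<bar>enn2ereal A\<bar> \<noteq> \<infinity>"
    using A by (cases A) (auto simp: enn2ereal_ennreal)
  have "(\<lambda>m. ereal (2 / Suc m) + enn2ereal A - enn2ereal (B m))
      \<longlonglongrightarrow> ereal 0 + enn2ereal A - enn2ereal (\<integral>\<^sup>+x. e2ennreal (- log_ennreal (f x)) \<partial>M)"
  proof (intro tendsto_diff_ereal_general tendsto_add_ereal_general tendsto_enn2erealI tendsto_const B_lim)
    show "(\<lambda>m. ereal (2 / Suc m)) \<longlonglongrightarrow> ereal 0"
      using LIMSEQ_Suc[OF lim_const_over_n[of 2]] by (intro tendsto_ereal) simp
  qed (use A_real in auto)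
  then have "L \<le> ereal 0 + enn2ereal A - enn2ereal (\<integral>\<^sup>+x. e2ennreal (- log_ennreal (f x)) \<partial>M)"
    using le by (intro LIMSEQ_le_const) auto
  then show ?thesis
    by (simp add: ext_integral_def A_def)
qed

section \<open>Tails of a generalized Riesz product\<close>

lemma sets_circle_measure [simp, measurable_cong]: "sets circle_measure = sets circle_borel"
  by (simp add: circle_measure_def)

lemma space_circle_measure [simp]: "space circle_measure = sphere 0 1"
  by (simp add: circle_measure_def)

interpretation circle: prob_space circle_measure
  by (rule prob_space_circle_measure)

lemma borel_measurable_continuous_circle:
  assumes "sets X = sets circle_borel" "continuous_on (sphere 0 1) (f :: complex \<Rightarrow> 'b::topological_space)"
  shows "f \<in> borel_measurable X"
  unfolding measurable_cong_sets[OF assms(1) refl]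
  using assms(2) by (rule borel_measurable_continuous_on_restrict)

lemma integrable_continuous_circle:
  fixes f :: "complex \<Rightarrow> real"
  assumes X: "finite_measure X" "sets X = sets circle_borel" and f: "continuous_on (sphere 0 1) f"
  shows "integrable X f"
proof -
  have "bounded (f ` sphere 0 1)"
    using f by (intro compact_imp_bounded compact_continuous_image compact_sphere)
  then obtain B where "\<forall>y\<in>f ` sphere 0 1. \<bar>y\<bar> \<le> B"
    unfolding bounded_real by (rule exE)
  then have "\<bar>f z\<bar> \<le> B" if "z \<in> space X" for z
    using that sets_eq_imp_space_eq[OF X(2)] by simp
  then have "- B \<le> f z \<and> f z \<le> B" if "z \<in> space X" for z
    using that by (simp add: abs_le_iff minus_le_iff)
  then show ?thesis
    using borel_measurable_continuous_circle[OF X(2) f] by (intro integrable_between[OF X(1)])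
qed

text \<open>The singular part is carried by \<open>Z\<close> and the absolutely continuous part does not charge \<open>Z\<close>, so the
  latter is the restriction of the whole measure to the complement of \<open>Z\<close>.\<close>

lemma abs_cont_part_density:
  assumes "abs_cont_part M N A" "sigma_finite_measure M" "sets N = sets M"
  obtains Z where "Z \<in> null_sets M"
    "density N (indicator (space M - Z)) = density M (RN_deriv M A)"
    "(\<integral>\<^sup>+x. RN_deriv M A x \<partial>M) \<le> emeasure N (space M)"
proof -
  from assms(1) obtain S Z where A: "sets A = sets M" "absolutely_continuous M A"
    and S: "sets S = sets M" "Z \<in> null_sets M" "emeasure S (space M - Z) = 0"
    and sum: "\<And>B. B \<in> sets M \<Longrightarrow> emeasure N B = emeasure A B + emeasure S B"
    unfolding abs_cont_part_def by blast
  have Z: "Z \<in> null_sets A"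
    using A S by (auto simp: absolutely_continuous_def)
  have [measurable]: "Z \<in> sets M"
    using S by auto
  have "density N (indicator (space M - Z)) = A"
  proof (rule measure_eqI)
    fix B assume "B \<in> sets (density N (indicator (space M - Z)))"
    then have B [measurable]: "B \<in> sets M"
      using assms by simp
    have "B \<subseteq> space M"
      using B by (rule sets.sets_into_space)
    then have eq: "(space M - Z) \<inter> B = B - Z"
      by auto
    have "emeasure S (B - Z) \<le> emeasure S (space M - Z)"
      using \<open>B \<subseteq> space M\<close> S by (intro emeasure_mono) auto
    then have "emeasure N (B - Z) = emeasure A (B - Z)"
      using S(3) by (simp add: sum)
    also have "\<dots> = emeasure A B"
      using Z A B by (intro emeasure_Diff_null_set) auto
    finally show "emeasure (density N (indicator (space M - Z))) B = emeasure A B"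
      using assms(3) by (subst emeasure_restricted) (auto simp: eq)
  qed (use A assms in simp)
  moreover have RN: "density M (RN_deriv M A) = A"
    by (rule sigma_finite_measure.density_RN_deriv[OF assms(2) A(2,1)])
  moreover have "(\<integral>\<^sup>+x. RN_deriv M A x \<partial>M) = emeasure A (space M)"
    by (subst RN[symmetric], subst emeasure_density) (auto cong: nn_integral_cong)
  ultimately show ?thesis
    using that[OF S(2)] sum[of "space M"] by simp
qed

lemma partial_product_eq:
  "partial_product Q n = density circle_measure (\<lambda>z. ennreal (\<Prod>j<n. (cmod (Q j z))\<^sup>2))"
  unfolding partial_product_def prod_norm[symmetric] prod_power_distrib ..

lemma integral_partial_product:
  fixes \<phi> :: "complex \<Rightarrow> real"
  assumes Q: "\<And>j. continuous_on (sphere 0 1) (Q j)" and \<phi>: "continuous_on (sphere 0 1) \<phi>"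
  shows "(\<integral>z. \<phi> z \<partial>partial_product Q n) = (\<integral>z. (\<Prod>j<n. (cmod (Q j z))\<^sup>2) * \<phi> z \<partial>circle_measure)"
  unfolding partial_product_eq
proof (subst integral_density)
  have p: "continuous_on (sphere 0 1) (\<lambda>z. \<Prod>j<n. (cmod (Q j z))\<^sup>2)"
    by (intro continuous_intros Q)
  show "\<phi> \<in> borel_measurable circle_measure"
    "(\<lambda>z. \<Prod>j<n. (cmod (Q j z))\<^sup>2) \<in> borel_measurable circle_measure"
    using \<phi> p by (intro borel_measurable_continuous_circle; simp)+
qed (simp_all add: prod_nonneg)

lemma prod_lessThan_add:
  fixes f :: "nat \<Rightarrow> 'a::comm_monoid_mult"
  shows "(\<Prod>j<n + k. f j) = (\<Prod>j<n. f j) * (\<Prod>j<k. f (n + j))"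
  by (induction k) (auto simp: mult.assoc)

text \<open>Multiplication by the continuous function \<open>|Q\<^sub>0 \<cdots> Q\<^sub>n\<^sub>-\<^sub>1|\<^sup>2\<close> is continuous for weak convergence, so the
  finite product can be split off from the limit.\<close>

lemma weak_limit_tail:
  assumes Q: "\<And>j. continuous_on (sphere 0 1) (Q j)"
    and \<mu>: "weak_limit (partial_product Q) \<mu>"
    and \<nu>: "weak_limit (partial_product (\<lambda>j. Q (n + j))) \<nu>"
  shows "\<mu> = density \<nu> (\<lambda>z. ennreal (\<Prod>j<n. (cmod (Q j z))\<^sup>2))"
proof (rule circle_measure_eqI_continuous)
  define p where "p z = (\<Prod>j<n. (cmod (Q j z))\<^sup>2)" for z
  have p: "continuous_on (sphere 0 1) p"
    unfolding p_def by (intro continuous_intros Q)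
  have p_nonneg: "0 \<le> p z" for z
    by (simp add: p_def prod_nonneg)
  have \<nu>_sets: "sets \<nu> = sets circle_borel" "finite_measure \<nu>"
    using \<nu> by (auto simp: weak_limit_def prob_space_def)
  note p_meas = borel_measurable_continuous_circle[OF \<nu>_sets(1) p]
  show "finite_measure \<mu>" "sets \<mu> = sets circle_borel"
    using \<mu> by (auto simp: weak_limit_def prob_space_def)
  show "sets (density \<nu> (\<lambda>z. ennreal (\<Prod>j<n. (cmod (Q j z))\<^sup>2))) = sets circle_borel"
    using \<nu>_sets by simp
  show "finite_measure (density \<nu> (\<lambda>z. ennreal (\<Prod>j<n. (cmod (Q j z))\<^sup>2)))"
    unfolding p_def[symmetric]
  proof (rule finite_measureI)
    have "(\<integral>\<^sup>+z. ennreal (p z) \<partial>\<nu>) < \<infinity>"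
      using integrable_continuous_circle[OF \<nu>_sets(2,1) p] p_nonneg
      by (subst nn_integral_eq_integral) auto
    then show "emeasure (density \<nu> (\<lambda>z. ennreal (p z))) (space (density \<nu> (\<lambda>z. ennreal (p z)))) \<noteq> \<infinity>"
      using p_meas by (simp add: emeasure_density cong: nn_integral_cong)
  qed
  fix \<phi> :: "complex \<Rightarrow> real" assume \<phi>: "continuous_on (sphere 0 1) \<phi>"
  have "(\<lambda>k. \<integral>z. \<phi> z \<partial>partial_product Q k) \<longlonglongrightarrow> (\<integral>z. \<phi> z \<partial>\<mu>)"
    using \<mu> \<phi> by (simp add: weak_limit_def)
  then have "(\<lambda>k. \<integral>z. \<phi> z \<partial>partial_product Q (n + k)) \<longlonglongrightarrow> (\<integral>z. \<phi> z \<partial>\<mu>)"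
    by (subst add.commute) (rule LIMSEQ_ignore_initial_segment)
  moreover have "(\<integral>z. \<phi> z \<partial>partial_product Q (n + k))
      = (\<integral>z. p z * \<phi> z \<partial>partial_product (\<lambda>j. Q (n + j)) k)" for k
    unfolding integral_partial_product[OF Q \<phi>] integral_partial_product[OF Q continuous_on_mult[OF p \<phi>]]
      prod_lessThan_add p_def[symmetric] by (simp only: mult_ac)
  moreover have "(\<lambda>k. \<integral>z. p z * \<phi> z \<partial>partial_product (\<lambda>j. Q (n + j)) k) \<longlonglongrightarrow> (\<integral>z. p z * \<phi> z \<partial>\<nu>)"
    using \<nu> continuous_on_mult[OF p \<phi>] by (simp add: weak_limit_def)
  ultimately have "(\<integral>z. \<phi> z \<partial>\<mu>) = (\<integral>z. p z * \<phi> z \<partial>\<nu>)"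
    using LIMSEQ_unique by simp
  also have "\<dots> = (\<integral>z. \<phi> z \<partial>density \<nu> (\<lambda>z. ennreal (p z)))"
    using p_meas p_nonneg borel_measurable_continuous_circle[OF \<nu>_sets(1) \<phi>] by (subst integral_density) auto
  finally show "(\<integral>z. \<phi> z \<partial>\<mu>) = (\<integral>z. \<phi> z \<partial>density \<nu> (\<lambda>z. ennreal (\<Prod>j<n. (cmod (Q j z))\<^sup>2)))"
    by (simp add: p_def)
qed

text \<open>Write \<open>\<mu> = p \<nu>\<close> with \<open>p\<close> the finite product and \<open>\<nu>\<close> the weak limit of the product of the remaining
  factors. The density \<open>f\<close> of the absolutely continuous part of \<open>\<mu>\<close> then vanishes where \<open>p\<close> does, and
  \<open>f / p\<close> is the density of a part of the probability measure \<open>\<nu>\<close>, so its integral is at most \<open>1\<close>.\<close>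

lemma ext_integral_log_ac_part_le:
  assumes Q: "\<And>j. continuous_on (sphere 0 1) (Q j)"
    and R: "generalized_Riesz_product Q \<mu>"
    and A: "abs_cont_part circle_measure \<mu> \<mu>\<^sub>a"
  shows "ext_integral circle_measure (\<lambda>z. log_ennreal (RN_deriv circle_measure \<mu>\<^sub>a z))
    \<le> ext_integral circle_measure (\<lambda>z. log_ennreal (ennreal (\<Prod>j<n. (cmod (Q j z))\<^sup>2)))"
proof -
  define f where "f = RN_deriv circle_measure \<mu>\<^sub>a"
  define p where "p z = (\<Prod>j<n. (cmod (Q j z))\<^sup>2)" for z
  have \<mu>: "weak_limit (partial_product Q) \<mu>" "sets \<mu> = sets circle_borel"
    using R by (auto simp: generalized_Riesz_product_def weak_limit_def)
  have "strict_mono (\<lambda>j. n + j)"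
    by (simp add: strict_mono_def)
  then obtain \<nu> where \<nu>: "weak_limit (partial_product (\<lambda>j. Q (n + j))) \<nu>"
    using R unfolding generalized_Riesz_product_def defines_generalized_Riesz_product_def by blast
  then have \<nu>_sets [measurable_cong]: "sets \<nu> = sets circle_borel" and "prob_space \<nu>"
    by (auto simp: weak_limit_def)
  interpret \<nu>: prob_space \<nu> by fact
  have \<mu>_eq: "\<mu> = density \<nu> (\<lambda>z. ennreal (p z))"
    unfolding p_def by (rule weak_limit_tail[OF Q \<mu>(1) \<nu>])
  have [measurable]: "p \<in> borel_measurable circle_borel"
    unfolding p_def by (intro borel_measurable_continuous_circle refl continuous_intros Q)
  have [measurable]: "f \<in> borel_measurable circle_borel"
    using borel_measurable_RN_deriv[of circle_measure] unfolding f_def by simp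
  obtain Z where Z: "Z \<in> null_sets circle_measure"
    and dens: "density \<mu> (indicator (sphere 0 1 - Z)) = density circle_measure f"
    and f_le: "(\<integral>\<^sup>+z. f z \<partial>circle_measure) \<le> emeasure \<mu> (sphere 0 1)"
    using abs_cont_part_density[OF A circle.sigma_finite_measure_axioms] \<mu>(2) unfolding f_def by auto
  have [measurable]: "Z \<in> sets circle_borel"
    using Z by auto
  then have [measurable]: "sphere 0 1 - Z \<in> sets circle_borel"
    using sets.Diff[OF sets.top[of circle_borel]] by simp
  have int_f: "(\<integral>\<^sup>+z. f z * h z \<partial>circle_measure) = (\<integral>\<^sup>+z. ennreal (p z) * (indicator (sphere 0 1 - Z) z * h z) \<partial>\<nu>)"
    if [measurable]: "h \<in> borel_measurable circle_borel" for h
  proof -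
    have "(\<integral>\<^sup>+z. f z * h z \<partial>circle_measure) = (\<integral>\<^sup>+z. h z \<partial>density circle_measure f)"
      by (subst nn_integral_density) auto
    also have "\<dots> = (\<integral>\<^sup>+z. indicator (sphere 0 1 - Z) z * h z \<partial>\<mu>)"
      unfolding dens[symmetric] by (subst nn_integral_density) (simp_all add: measurable_cong_sets[OF \<mu>(2) refl])
    also have "\<dots> = (\<integral>\<^sup>+z. ennreal (p z) * (indicator (sphere 0 1 - Z) z * h z) \<partial>\<nu>)"
      unfolding \<mu>_eq by (subst nn_integral_density) auto
    finally show ?thesis .
  qed
  have "(\<integral>\<^sup>+z. f z / ennreal (p z) \<partial>circle_measure) \<le> (\<integral>\<^sup>+z. 1 \<partial>\<nu>)"
    unfolding divide_ennreal_def
  proof (subst int_f)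
    have "ennreal (p z) * (indicator (sphere 0 1 - Z) z * inverse (ennreal (p z))) \<le> 1" for z
    proof (cases "p z > 0")
      case True
      then have "ennreal (p z) * inverse (ennreal (p z)) = 1"
        by (simp add: inverse_ennreal ennreal_mult[symmetric] del: ennreal_mult)
      then show ?thesis
        by (simp add: indicator_def)
    qed (simp add: ennreal_neg)
    then show "(\<integral>\<^sup>+z. ennreal (p z) * (indicator (sphere 0 1 - Z) z * inverse (ennreal (p z))) \<partial>\<nu>) \<le> (\<integral>\<^sup>+z. 1 \<partial>\<nu>)"
      by (rule nn_integral_mono)
  qed measurable
  then have quot: "(\<integral>\<^sup>+z. f z / ennreal (p z) \<partial>circle_measure) \<le> 1"
    by (simp add: \<nu>.emeasure_space_1)
  have "(\<integral>\<^sup>+z. f z * indicator {0} (p z) \<partial>circle_measure) = 0"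
  proof (subst int_f)
    have "ennreal (p z) * (indicator (sphere 0 1 - Z) z * indicator {0} (p z)) = 0" for z
      by (cases "p z = 0") simp_all
    then show "(\<integral>\<^sup>+z. ennreal (p z) * (indicator (sphere 0 1 - Z) z * indicator {0} (p z)) \<partial>\<nu>) = 0"
      by (simp only: nn_integral_const mult_zero_left)
  qed measurable
  then have zero: "AE z in circle_measure. p z = 0 \<longrightarrow> f z = 0"
    by (subst (asm) nn_integral_0_iff_AE) (auto simp: indicator_def elim!: eventually_mono)
  have "(\<integral>\<^sup>+z. f z \<partial>circle_measure) < \<infinity>"
    using f_le R sets_eq_imp_space_eq[OF \<mu>(2)] prob_space.emeasure_space_1[of \<mu>]
    by (auto simp: generalized_Riesz_product_def weak_limit_def less_top[symmetric] top_unique)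
  moreover have "0 \<le> p z" for z
    by (simp add: p_def prod_nonneg)
  ultimately have "ext_integral circle_measure (\<lambda>z. log_ennreal (f z))
      \<le> ext_integral circle_measure (\<lambda>z. log_ennreal (ennreal (p z)))"
    by (intro ext_integral_log_mono_quotient[OF prob_space_circle_measure _ _ _ _ quot zero])
      simp_all
  then show ?thesis
    by (simp add: f_def p_def)
qed


section \<open>Semicontinuity of the logarithmic integral\<close>

text \<open>This is \<open>log (\<phi> p) \<le> \<phi> p - 1\<close>, integrated. Its right-hand side depends on \<open>p\<close> only through the
  integral of \<open>\<phi>\<close> with respect to \<open>p dM\<close>, and hence passes to weak limits; equality would require
  \<open>\<phi> = 1 / p\<close>.\<close>

lemma ext_integral_log_le_integral:
  assumes "prob_space M" and p: "integrable M (\<lambda>x. \<phi> x * p x)" and \<phi>: "integrable M (\<lambda>x. ln (\<phi> x))"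
    and pos: "\<And>x. x \<in> space M \<Longrightarrow> 0 < \<phi> x" "\<And>x. x \<in> space M \<Longrightarrow> 0 \<le> p x"
  shows "ext_integral M (\<lambda>x. log_ennreal (ennreal (p x)))
    \<le> ereal ((\<integral>x. \<phi> x * p x \<partial>M) - 1 - (\<integral>x. ln (\<phi> x) \<partial>M))"
proof -
  interpret prob_space M by fact
  have "ext_integral M (\<lambda>x. log_ennreal (ennreal (p x))) \<le> ext_integral M (\<lambda>x. ereal (\<phi> x * p x - 1 - ln (\<phi> x)))"
  proof (intro ext_integral_mono_AE AE_I2)
    fix x assume x: "x \<in> space M"
    show "log_ennreal (ennreal (p x)) \<le> ereal (\<phi> x * p x - 1 - ln (\<phi> x))"
    proof (cases "p x = 0")
      case False
      then have "0 < p x"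
        using pos(2)[OF x] by simp
      then show ?thesis
        using pos(1)[OF x] ln_le_minus_one[of "\<phi> x * p x"] by (simp add: log_ennreal_ereal ln_mult)
    qed (simp add: log_ennreal_def)
  qed
  also have "\<dots> = ereal (\<integral>x. \<phi> x * p x - 1 - ln (\<phi> x) \<partial>M)"
    using p \<phi> by (intro ext_integral_eq_integral) auto
  also have "(\<integral>x. \<phi> x * p x - 1 - ln (\<phi> x) \<partial>M) = (\<integral>x. \<phi> x * p x \<partial>M) - 1 - (\<integral>x. ln (\<phi> x) \<partial>M)"
    using p \<phi> by (simp add: prob_space)
  finally show ?thesis .
qed

lemma limsup_log_le_continuous:
  fixes \<phi> :: "complex \<Rightarrow> real"
  assumes Q: "\<And>j. continuous_on (sphere 0 1) (Q j)"
    and \<mu>: "weak_limit (partial_product Q) \<mu>"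
    and \<phi>: "continuous_on (sphere 0 1) \<phi>" "\<And>z. z \<in> sphere 0 1 \<Longrightarrow> 0 < \<phi> z"
  shows "limsup (\<lambda>n. ext_integral circle_measure (\<lambda>z. log_ennreal (ennreal (\<Prod>j<n. (cmod (Q j z))\<^sup>2))))
    \<le> ereal ((\<integral>z. \<phi> z \<partial>\<mu>) - 1 - (\<integral>z. ln (\<phi> z) \<partial>circle_measure))"
proof -
  have "ext_integral circle_measure (\<lambda>z. log_ennreal (ennreal (\<Prod>j<n. (cmod (Q j z))\<^sup>2)))
      \<le> ereal ((\<integral>z. \<phi> z \<partial>partial_product Q n) - 1 - (\<integral>z. ln (\<phi> z) \<partial>circle_measure))" for n
    unfolding integral_partial_product[OF Q \<phi>(1)]
  proof (subst mult.commute, rule ext_integral_log_le_integral[OF prob_space_circle_measure])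
    show "integrable circle_measure (\<lambda>z. \<phi> z * (\<Prod>j<n. (cmod (Q j z))\<^sup>2))"
      by (intro integrable_continuous_circle circle.finite_measure_axioms sets_circle_measure
          continuous_intros Q \<phi>(1))
    show "integrable circle_measure (\<lambda>z. ln (\<phi> z))"
    proof (intro integrable_continuous_circle circle.finite_measure_axioms sets_circle_measure continuous_on_ln \<phi>(1) ballI)
      show "\<phi> z \<noteq> 0" if "z \<in> sphere 0 1" for z
        using \<phi>(2)[OF that] by simp
    qed
  qed (use \<phi>(2) in \<open>auto simp: prod_nonneg\<close>)
  then have "limsup (\<lambda>n. ext_integral circle_measure (\<lambda>z. log_ennreal (ennreal (\<Prod>j<n. (cmod (Q j z))\<^sup>2))))
      \<le> limsup (\<lambda>n. ereal ((\<integral>z. \<phi> z \<partial>partial_product Q n) - 1 - (\<integral>z. ln (\<phi> z) \<partial>circle_measure)))"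
    by (intro Limsup_mono always_eventually allI)
  also have "\<dots> = ereal ((\<integral>z. \<phi> z \<partial>\<mu>) - 1 - (\<integral>z. ln (\<phi> z) \<partial>circle_measure))"
    using \<mu> \<phi>(1) by (intro lim_imp_Limsup tendsto_ereal tendsto_diff tendsto_const) (auto simp: weak_limit_def)
  finally show ?thesis .
qed

text \<open>A bounded measurable weight is approximated by continuous weights with the same bounds, in \<open>L\<^sup>1\<close> of
  both \<open>\<mu>\<close> and \<open>dz\<close>. The lower bound \<open>a\<close> makes the logarithm Lipschitz with constant \<open>1 / a\<close> on the
  values that occur.\<close>

lemma limsup_log_le_measurable:
  fixes g :: "complex \<Rightarrow> real"
  assumes Q: "\<And>j. continuous_on (sphere 0 1) (Q j)"
    and \<mu>: "weak_limit (partial_product Q) \<mu>"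
    and g: "g \<in> borel_measurable circle_borel"
    and bounds: "0 < a" "a \<le> b" "\<And>z. z \<in> sphere 0 1 \<Longrightarrow> a \<le> g z \<and> g z \<le> b"
  shows "limsup (\<lambda>n. ext_integral circle_measure (\<lambda>z. log_ennreal (ennreal (\<Prod>j<n. (cmod (Q j z))\<^sup>2))))
    \<le> ereal ((\<integral>z. g z \<partial>\<mu>) - 1 - (\<integral>z. ln (g z) \<partial>circle_measure))"
proof -
  have \<mu>_fin: "finite_measure \<mu>" "sets \<mu> = sets circle_borel"
    using \<mu> by (auto simp: weak_limit_def prob_space_def)
  obtain \<phi> :: "nat \<Rightarrow> complex \<Rightarrow> real" where \<phi>: "\<And>k. continuous_on UNIV (\<phi> k)"
    "\<And>k z. a \<le> \<phi> k z \<and> \<phi> k z \<le> b"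
    "(\<lambda>k. \<integral>z. \<bar>\<phi> k z - g z\<bar> \<partial>circle_measure) \<longlonglongrightarrow> 0" "(\<lambda>k. \<integral>z. \<bar>\<phi> k z - g z\<bar> \<partial>\<mu>) \<longlonglongrightarrow> 0"
    by (rule circle_continuous_approx[OF circle.finite_measure_axioms sets_circle_measure \<mu>_fin g bounds(3,2)])
      auto
  have \<phi>_pos: "0 < \<phi> k z" for k z
    using \<phi>(2)[of k z] bounds(1) by linarith
  have \<phi>_sphere: "continuous_on (sphere 0 1) (\<phi> k)" for k
    using \<phi>(1) continuous_on_subset by blast
  have [measurable]: "\<phi> k \<in> borel_measurable circle_borel" for k
    by (rule borel_measurable_continuous_circle[OF refl \<phi>_sphere])
  note g[measurable]
  have int_g: "integrable X g" if "finite_measure X" "sets X = sets circle_borel" for X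
    using that bounds(3) g sets_eq_imp_space_eq[OF that(2)]
    by (intro integrable_between[where a = a and b = b]) (simp_all add: measurable_cong_sets[OF that(2) refl])
  have int_ln: "integrable circle_measure (\<lambda>z. ln (h z))"
    if h: "h \<in> borel_measurable circle_borel" "\<And>z. z \<in> sphere 0 1 \<Longrightarrow> a \<le> h z \<and> h z \<le> b" for h :: "complex \<Rightarrow> real"
  proof (rule integrable_between[OF circle.finite_measure_axioms, where a = "ln a" and b = "ln b"])
    show "(\<lambda>z. ln (h z)) \<in> borel_measurable circle_measure"
      using h(1) by measurable
    show "ln a \<le> ln (h z) \<and> ln (h z) \<le> ln b" if z: "z \<in> space circle_measure" for z
      using h(2)[of z] z bounds(1) by auto
  qed
  have "(\<lambda>k. \<integral>z. \<phi> k z \<partial>\<mu>) \<longlonglongrightarrow> (\<integral>z. g z \<partial>\<mu>)"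
    using \<phi>(4) by (intro tendsto_integral_L1 integrable_continuous_circle \<mu>_fin \<phi>_sphere int_g)
  moreover have "(\<lambda>k. \<integral>z. ln (\<phi> k z) \<partial>circle_measure) \<longlonglongrightarrow> (\<integral>z. ln (g z) \<partial>circle_measure)"
  proof (rule tendsto_integral_L1)
    show ints: "integrable circle_measure (\<lambda>z. ln (\<phi> k z))" "integrable circle_measure (\<lambda>z. ln (g z))" for k
      using \<phi>(2) bounds(3) by (auto intro!: int_ln)
    have ln_lip: "\<bar>ln s - ln t\<bar> \<le> \<bar>s - t\<bar> / a" if "a \<le> s" "a \<le> t" for s t
    proof -
      have *: "ln s - ln t \<le> \<bar>s - t\<bar> / a" if "a \<le> s" "a \<le> t" for s t
      proof -
        have "ln (s / t) \<le> s / t - 1"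
          using that bounds(1) by (intro ln_le_minus_one) simp
        also have "\<dots> = (s - t) / t"
          using that bounds(1) by (simp add: field_simps)
        also have "\<dots> \<le> \<bar>s - t\<bar> / a"
          using that bounds(1) by (intro frac_le) auto
        finally show ?thesis
          using that bounds(1) by (simp add: ln_div)
      qed
      show ?thesis
        using *[OF that] *[OF that(2,1)] by (simp add: abs_le_iff abs_minus_commute)
    qed
    have int_diff: "integrable circle_measure (\<lambda>z. \<bar>\<phi> k z - g z\<bar> / a)" for k
      using integrable_continuous_circle[OF circle.finite_measure_axioms sets_circle_measure \<phi>_sphere]
        int_g[OF circle.finite_measure_axioms sets_circle_measure] by auto
    have lim: "(\<lambda>k. (\<integral>z. \<bar>\<phi> k z - g z\<bar> / a \<partial>circle_measure)) \<longlonglongrightarrow> 0"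
      using tendsto_divide[OF \<phi>(3) tendsto_const[of a]] bounds(1) by simp
    show "(\<lambda>k. \<integral>z. \<bar>ln (\<phi> k z) - ln (g z)\<bar> \<partial>circle_measure) \<longlonglongrightarrow> 0"
    proof (rule tendsto_sandwich[OF _ _ tendsto_const lim])
      have "(\<integral>z. \<bar>ln (\<phi> k z) - ln (g z)\<bar> \<partial>circle_measure) \<le> (\<integral>z. \<bar>\<phi> k z - g z\<bar> / a \<partial>circle_measure)" for k
      proof (rule integral_mono[OF _ int_diff])
        show "integrable circle_measure (\<lambda>z. \<bar>ln (\<phi> k z) - ln (g z)\<bar>)"
          using ints by simp
        show "\<bar>ln (\<phi> k z) - ln (g z)\<bar> \<le> \<bar>\<phi> k z - g z\<bar> / a" if "z \<in> space circle_measure" for z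
          using \<phi>(2)[of k z] bounds(3)[of z] that by (intro ln_lip) auto
      qed
      then show "\<forall>\<^sub>F k in sequentially. (\<integral>z. \<bar>ln (\<phi> k z) - ln (g z)\<bar> \<partial>circle_measure)
          \<le> (\<integral>z. \<bar>\<phi> k z - g z\<bar> / a \<partial>circle_measure)"
        by simp
    qed simp
  qed
  ultimately have "(\<lambda>k. ereal ((\<integral>z. \<phi> k z \<partial>\<mu>) - 1 - (\<integral>z. ln (\<phi> k z) \<partial>circle_measure)))
      \<longlonglongrightarrow> ereal ((\<integral>z. g z \<partial>\<mu>) - 1 - (\<integral>z. ln (g z) \<partial>circle_measure))"
    by (intro tendsto_ereal tendsto_diff tendsto_const)
  then show ?thesis
    using limsup_log_le_continuous[OF Q \<mu> \<phi>_sphere \<phi>_pos]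
    by (rule tendsto_lowerbound[OF _ always_eventually[OF allI] sequentially_bot])
qed

text \<open>The weight in the preceding inequality should be \<open>1 / f\<close>, where \<open>f\<close> is the density of the absolutely
  continuous part, and it should vanish on the null set \<open>Z\<close> that carries the singular part. With \<open>f\<close>
  truncated to the interval from \<open>1 / M\<close> to \<open>M\<close>, and the value \<open>1 / M\<close> on \<open>Z\<close>, its integral with respect to
  \<open>\<mu>\<close> exceeds \<open>1\<close> by at most \<open>2 / M\<close>: once for the truncation from above and once for \<open>Z\<close>. The
  truncation from below only decreases the integral.\<close>

lemma limsup_le_ext_integral_log_ac_part:
  assumes Q: "\<And>j. continuous_on (sphere 0 1) (Q j)"
    and \<mu>: "weak_limit (partial_product Q) \<mu>"
    and A: "abs_cont_part circle_measure \<mu> \<mu>\<^sub>a"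
  shows "limsup (\<lambda>n. ext_integral circle_measure (\<lambda>z. log_ennreal (ennreal (\<Prod>j<n. (cmod (Q j z))\<^sup>2))))
    \<le> ext_integral circle_measure (\<lambda>z. log_ennreal (RN_deriv circle_measure \<mu>\<^sub>a z))"
proof -
  define f where "f = RN_deriv circle_measure \<mu>\<^sub>a"
  have \<mu>_sets [measurable_cong]: "sets \<mu> = sets circle_borel" and "prob_space \<mu>"
    using \<mu> by (auto simp: weak_limit_def)
  interpret \<mu>: prob_space \<mu> by fact
  have space_\<mu>: "space \<mu> = sphere 0 1"
    using sets_eq_imp_space_eq[OF \<mu>_sets] by simp
  have [measurable]: "f \<in> borel_measurable circle_borel"
    using borel_measurable_RN_deriv[of circle_measure] unfolding f_def by simp
  obtain Z where Z: "Z \<in> null_sets circle_measure"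
    and dens: "density \<mu> (indicator (sphere 0 1 - Z)) = density circle_measure f"
    and "(\<integral>\<^sup>+z. f z \<partial>circle_measure) \<le> emeasure \<mu> (sphere 0 1)"
    using abs_cont_part_density[OF A circle.sigma_finite_measure_axioms] \<mu>_sets unfolding f_def by auto
  then have f_le: "(\<integral>\<^sup>+z. f z \<partial>circle_measure) \<le> 1"
    using \<mu>.emeasure_space_1 space_\<mu> by simp
  have [measurable]: "Z \<in> sets circle_borel"
    using Z by auto
  then have [measurable]: "sphere 0 1 - Z \<in> sets circle_borel"
    using sets.Diff[OF sets.top[of circle_borel]] by simp
  have fin: "AE z in circle_measure. f z \<noteq> \<infinity>"
    using f_le by (intro nn_integral_PInf_AE) (auto simp: top_unique)
  have "limsup (\<lambda>n. ext_integral circle_measure (\<lambda>z. log_ennreal (ennreal (\<Prod>j<n. (cmod (Q j z))\<^sup>2))))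
    \<le> ereal (2 / Suc m + (\<integral>z. ln (max (1 / Suc m) (min (Suc m) (enn2real (f z)))) \<partial>circle_measure))" for m
  proof -
    define M where "M = real (Suc m)"
    have M: "1 \<le> M"
      by (simp add: M_def)
    then have "1 / M \<le> 1"
      by simp
    with M have M_inv: "1 / M \<le> M"
      by linarith
    define c where "c z = max (1 / M) (min M (enn2real (f z)))" for z
    have c_bounds: "1 / M \<le> c z" "c z \<le> M" for z
      using M M_inv unfolding c_def by (auto intro: order_trans)
    have c_pos: "0 < c z" for z
      by (rule less_le_trans[OF _ c_bounds(1)]) (use M in simp)
    define g where "g z = (if z \<in> Z then 1 / M else 1 / c z)" for z
    have [measurable]: "c \<in> borel_measurable circle_borel"
      unfolding c_def by measurable
    have g_meas [measurable]: "g \<in> borel_measurable circle_borel"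
      unfolding g_def by measurable
    have g_bounds: "1 / M \<le> g z \<and> g z \<le> M" for z
    proof -
      have "1 / c z \<le> M"
        using c_bounds(1)[of z] c_pos[of z] M by (simp add: field_simps)
      moreover have "1 / M \<le> 1 / c z"
        using c_bounds(2)[of z] c_pos[of z] by (intro divide_left_mono) (use M in simp_all)
      ultimately show ?thesis
        using M M_inv by (simp add: g_def)
    qed
    have "(\<integral>\<^sup>+z. ennreal (g z) \<partial>\<mu>) \<le> (\<integral>\<^sup>+z. indicator (sphere 0 1 - Z) z * ennreal (g z) + ennreal (1 / M) \<partial>\<mu>)"
      using space_\<mu> by (intro nn_integral_mono) (auto simp: indicator_def g_def)
    also have "\<dots> = (\<integral>\<^sup>+z. ennreal (g z) \<partial>density \<mu> (indicator (sphere 0 1 - Z))) + ennreal (1 / M)"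
      using \<mu>.emeasure_space_1
      by (simp add: nn_integral_add nn_integral_density measurable_cong_sets[OF \<mu>_sets refl])
    also have "(\<integral>\<^sup>+z. ennreal (g z) \<partial>density \<mu> (indicator (sphere 0 1 - Z))) = (\<integral>\<^sup>+z. f z * ennreal (g z) \<partial>circle_measure)"
      unfolding dens by (subst nn_integral_density) auto
    also have "\<dots> \<le> (\<integral>\<^sup>+z. 1 + f z * ennreal (1 / M) \<partial>circle_measure)"
    proof (rule nn_integral_mono_AE)
      show "AE z in circle_measure. f z * ennreal (g z) \<le> 1 + f z * ennreal (1 / M)"
        using fin AE_not_in[OF Z]
      proof eventually_elim
        case (elim z)
        then obtain r where r: "f z = ennreal r" "0 \<le> r"
          by (cases "f z") auto
        \<comment> \<open>Up to \<open>M\<close> truncation only raises \<open>f\<close>, and \<open>f g \<le> 1\<close>; beyond \<open>M\<close> the weight is \<open>1 / M\<close>.\<close>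
        have "r * g z \<le> 1 + r * (1 / M)"
        proof (cases "r \<le> M")
          case True
          then have "r \<le> c z"
            using r by (simp add: c_def)
          then have "r * g z \<le> 1"
            using elim c_pos[of z] by (simp add: g_def field_simps)
          moreover have "0 \<le> r * (1 / M)"
            using r M by simp
          ultimately show ?thesis
            by linarith
        next
          case False
          then have "c z = M"
            using r M_inv by (simp add: c_def)
          then show ?thesis
            using elim by (simp add: g_def)
        qed
        then have "ennreal (r * g z) \<le> ennreal (1 + r * (1 / M))"
          by (rule ennreal_leI)
        also have "ennreal (1 + r * (1 / M)) = ennreal 1 + ennreal (r * (1 / M))"
          using r M by (intro ennreal_plus) auto
        finally show ?case
          unfolding r(1) ennreal_mult'[OF r(2)] ennreal_1 .
      qed
    qed
    also have "\<dots> = 1 + (\<integral>\<^sup>+z. f z \<partial>circle_measure) * ennreal (1 / M)"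
      using circle.emeasure_space_1 by (simp add: nn_integral_add nn_integral_multc)
    also have "\<dots> \<le> 1 + 1 * ennreal (1 / M)"
      using f_le by (intro add_left_mono mult_right_mono) auto
    finally have "(\<integral>\<^sup>+z. ennreal (g z) \<partial>\<mu>) \<le> 1 + 1 * ennreal (1 / M) + ennreal (1 / M)"
      by (simp add: add_right_mono)
    also have "\<dots> = ennreal 1 + ennreal (1 / M) + ennreal (1 / M)"
      by simp
    also have "\<dots> = ennreal (1 + 1 / M) + ennreal (1 / M)"
      using M by (subst ennreal_plus) auto
    also have "\<dots> = ennreal (1 + 1 / M + 1 / M)"
      using M by (intro ennreal_plus[symmetric]) auto
    also have "1 + 1 / M + 1 / M = 1 + 2 / M"
      by simp
    finally have int_g: "(\<integral>z. g z \<partial>\<mu>) \<le> 1 + 2 / M"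
      using M by (intro integral_real_bounded) auto
    have "(\<integral>z. ln (g z) \<partial>circle_measure) = (\<integral>z. - ln (c z) \<partial>circle_measure)"
    proof (rule integral_cong_AE)
      show "AE z in circle_measure. ln (g z) = - ln (c z)"
        using AE_not_in[OF Z] by eventually_elim (use c_pos in \<open>simp add: g_def ln_div\<close>)
    qed measurable
    then have ln_g: "(\<integral>z. ln (g z) \<partial>circle_measure) = - (\<integral>z. ln (c z) \<partial>circle_measure)"
      by simp
    have "limsup (\<lambda>n. ext_integral circle_measure (\<lambda>z. log_ennreal (ennreal (\<Prod>j<n. (cmod (Q j z))\<^sup>2))))
        \<le> ereal ((\<integral>z. g z \<partial>\<mu>) - 1 - (\<integral>z. ln (g z) \<partial>circle_measure))"
      using M g_bounds by (intro limsup_log_le_measurable[OF Q \<mu> g_meas, where a = "1 / M" and b = M])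
        (auto intro: order_trans[OF g_bounds[THEN conjunct1] g_bounds[THEN conjunct2]])
    also have "\<dots> \<le> ereal (2 / M + (\<integral>z. ln (c z) \<partial>circle_measure))"
      using int_g ln_g by simp
    finally show ?thesis
      by (simp add: c_def M_def)
  qed
  then have "limsup (\<lambda>n. ext_integral circle_measure (\<lambda>z. log_ennreal (ennreal (\<Prod>j<n. (cmod (Q j z))\<^sup>2))))
      \<le> ext_integral circle_measure (\<lambda>z. log_ennreal (f z))"
    using f_le by (intro le_ext_integral_log_of_truncations[OF prob_space_circle_measure])
      (auto intro: le_less_trans)
  then show ?thesis
    by (simp add: f_def)
qed

section \<open>The logarithmic integral of a generalized Riesz product\<close>

theorem theorem3p1:
  fixes P :: "nat \<Rightarrow> complex poly" and \<mu> \<mu>\<^sub>a :: "complex measure"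
  assumes "generalized_Riesz_product (\<lambda>j. poly (P j)) \<mu>"
    and "\<And>j. Im (coeff (P j) 0) = 0 \<and> Re (coeff (P j) 0) > 0"
    and "abs_cont_part circle_measure \<mu> \<mu>\<^sub>a"
  shows "(\<lambda>n. ext_integral circle_measure
             (\<lambda>z. log_ennreal (ennreal (\<Prod>j<n. (cmod (poly (P j) z))\<^sup>2))))
           \<longlonglongrightarrow> ext_integral circle_measure (\<lambda>z. log_ennreal (RN_deriv circle_measure \<mu>\<^sub>a z))
         \<and> ext_integral circle_measure (\<lambda>z. log_ennreal (RN_deriv circle_measure \<mu>\<^sub>a z)) \<in> {-\<infinity>..0}"
proof -
  define L where "L n = ext_integral circle_measure
    (\<lambda>z. log_ennreal (ennreal (\<Prod>j<n. (cmod (poly (P j) z))\<^sup>2)))" for n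
  define I where "I = ext_integral circle_measure (\<lambda>z. log_ennreal (RN_deriv circle_measure \<mu>\<^sub>a z))"
  have Q: "continuous_on (sphere 0 1) (\<lambda>z. poly (P j) z)" for j
    by (intro continuous_intros)
  have lower: "I \<le> L n" for n
    unfolding I_def L_def by (rule ext_integral_log_ac_part_le[OF Q assms(1,3)])
  have upper: "limsup L \<le> I"
    using assms(1) unfolding I_def L_def[abs_def]
    by (intro limsup_le_ext_integral_log_ac_part[OF Q _ assms(3)]) (simp add: generalized_Riesz_product_def)
  have "I \<le> liminf L"
    using lower by (intro Liminf_bounded) simp
  then have "L \<longlonglongrightarrow> I"
    using upper Liminf_le_Limsup[of sequentially L]
    by (intro Liminf_eq_Limsup) (auto intro: antisym order_trans)
  \<comment> \<open>The empty product gives the upper bound \<open>0\<close>.\<close>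
  moreover have "L 0 = 0"
    by (simp add: L_def log_ennreal_def ext_integral_def)
  then have "I \<le> 0"
    using lower[of 0] by simp
  ultimately show ?thesis
    unfolding I_def L_def[abs_def] by simp
qed

end
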